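(* Let $X$ be a finite indecomposable q-cycle set. Then $X$ has finite primitive level if and only if there exists a maximal imprimitive blocks system $\{\Delta_x\}_{x\in X}$ of $\mathcal{G}(X)$ such that $\mathrm{Dis}(X,\Delta)\leq\mathrm{Fix}(\{\Delta_x\}_{x\in X})$ for every $\Delta\in\{\Delta_x\}_{x\in X}$.
   Context: A q-cycle set is a non-empty set $X$ with two binary operations $\cdot$ and $:$ such that for every $x\in X$ the map $\sigma_x:X\to X$, $y\mapsto x\cdot y$ is bijective, and for all $x,y,z\in X$: $(x\cdot y)\cdot(x\cdot z)=(y:x)\cdot(y\cdot z)$, $(x:y):(x:z)=(y\cdot x):(y:z)$, and $(x\cdot y):(x\cdot z)=(y:x)\cdot(y:z)$. It is regular if $\delta_x:X\to X$, $y\mapsto x:y$ is bijective for every $x\in X$. For a regular q-cycle set, $\mathcal{G}(X)=\langle\sigma_x,\delta_x\mid x\in X\rangle\le\mathrm{Sym}_X$, and $X$ is indecomposable if $X$ is regular and $\mathcal{G}(X)$ acts transitively on $X$. All q-cycle sets are finite. Let $G$ be a finite group acting transitively on a finite set $X$. The group $G$ is imprimitive if there exists a subset $\Delta$ of $X$, $\Delta\neq X$, with at least two elements, called a block for $G$, such that for each $g\in G$ either $g(\Delta)=\Delta$ or $g(\Delta)\cap\Delta=\emptyset$; the set $\{g(\Delta)\}_{g\in G}$ is then a partition of $X$, called an imprimitive blocks system and written $\{\Delta_x\}_{x\in X}$ with $\Delta_x$ the member containing $x$. The action is primitive if it is transitive and not imprimitive. A block $\Delta$ is maximal if, for every block $\Delta'$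 with $\Delta\subseteq\Delta'\subseteq X$, one has $\Delta=\Delta'$ or $\Delta'=X$; an imprimitive blocks system is maximal if one (and hence all) of its blocks is maximal. For an imprimitive blocks system $\mathcal{B}$, $\mathrm{Fix}(\mathcal{B})=\bigcap_{\Delta\in\mathcal{B}}\{g\in G\mid g(\Delta)=\Delta\}$; here $G=\mathcal{G}(X)$. For a block $\Delta$ of $\mathcal{G}(X)$, $\mathrm{Dis}(X,\Delta):=\langle\sigma_x^{-1}\sigma_y,\ \delta_x^{-1}\delta_y\mid x,y\in\Delta\rangle$. A q-cycle set $X$ is primitive if $\mathcal{G}(X)$ acts primitively on $X$. A finite indecomposable q-cycle set $X$ has primitive level $k$ if $k$ is the biggest positive integer such that there exist q-cycle sets $X_1=X,X_2,\dots,X_k$ with $|X_i|>|X_{i+1}|>1$ and epimorphisms (surjective homomorphisms) of q-cycle sets $p_{i+1}:X_i\to X_{i+1}$ for every $1\le i\le k-1$, and with $X_k$ primitive. $X$ has finite primitive level if such a $k$ exists.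
   Formalization: As stated the claim fails for primitive X (level finite via k=1, but no blocks system exists); the formal statement adds "X is primitive or" to the right-hand side. Chain members X_i are taken over the same underlying type as X, harmless up to isomorphism. *)

theory Defs
  imports "HOL-Algebra.Group_Action" "HOL-Algebra.Generated_Groups"
begin

section \<open>Blocks of a group action\<close>

text \<open>A group \<open>G\<close> acts on a set \<open>E\<close> through a map \<open>\<phi>\<close>, as in \<^locale>\<open>group_action\<close>.
  Singletons and \<open>E\<close> itself are not blocks. The bound \<open>2 \<le> card \<Delta>\<close> is the intended one
  since all sets acted upon are finite.\<close>

definition is_block ::
    "('g, 'm) monoid_scheme \<Rightarrow> 'a set \<Rightarrow> ('g \<Rightarrow> 'a \<Rightarrow> 'a) \<Rightarrow> 'a set \<Rightarrow> bool" where
  "is_block G E \<phi> \<Delta> \<longleftrightarrow>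
     \<Delta> \<subseteq> E \<and> \<Delta> \<noteq> E \<and> 2 \<le> card \<Delta> \<and>
     (\<forall>g \<in> carrier G. \<phi> g ` \<Delta> = \<Delta> \<or> \<phi> g ` \<Delta> \<inter> \<Delta> = {})"

definition maximal_block ::
    "('g, 'm) monoid_scheme \<Rightarrow> 'a set \<Rightarrow> ('g \<Rightarrow> 'a \<Rightarrow> 'a) \<Rightarrow> 'a set \<Rightarrow> bool" where
  "maximal_block G E \<phi> \<Delta> \<longleftrightarrow>
     is_block G E \<phi> \<Delta> \<and>
     (\<forall>\<Delta>'. is_block G E \<phi> \<Delta>' \<and> \<Delta> \<subseteq> \<Delta>' \<and> \<Delta>' \<subseteq> E \<longrightarrow> \<Delta> = \<Delta>' \<or> \<Delta>' = E)"

definition imprimitive_action ::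
    "('g, 'm) monoid_scheme \<Rightarrow> 'a set \<Rightarrow> ('g \<Rightarrow> 'a \<Rightarrow> 'a) \<Rightarrow> bool" where
  "imprimitive_action G E \<phi> \<longleftrightarrow> (\<exists>\<Delta>. is_block G E \<phi> \<Delta>)"

definition primitive_action ::
    "('g, 'm) monoid_scheme \<Rightarrow> 'a set \<Rightarrow> ('g \<Rightarrow> 'a \<Rightarrow> 'a) \<Rightarrow> bool" where
  "primitive_action G E \<phi> \<longleftrightarrow> transitive_action G E \<phi> \<and> \<not> imprimitive_action G E \<phi>"

definition imprimitive_blocks_system ::
    "('g, 'm) monoid_scheme \<Rightarrow> 'a set \<Rightarrow> ('g \<Rightarrow> 'a \<Rightarrow> 'a) \<Rightarrow> 'a set set \<Rightarrow> bool" where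
  "imprimitive_blocks_system G E \<phi> \<B> \<longleftrightarrow>
     (\<exists>\<Delta>. is_block G E \<phi> \<Delta> \<and> \<B> = (\<lambda>g. \<phi> g ` \<Delta>) ` carrier G)"

definition maximal_imprimitive_blocks_system ::
    "('g, 'm) monoid_scheme \<Rightarrow> 'a set \<Rightarrow> ('g \<Rightarrow> 'a \<Rightarrow> 'a) \<Rightarrow> 'a set set \<Rightarrow> bool" where
  "maximal_imprimitive_blocks_system G E \<phi> \<B> \<longleftrightarrow>
     imprimitive_blocks_system G E \<phi> \<B> \<and> (\<exists>\<Delta> \<in> \<B>. maximal_block G E \<phi> \<Delta>)"

definition fix_blocks ::
    "('g, 'm) monoid_scheme \<Rightarrow> ('g \<Rightarrow> 'a \<Rightarrow> 'a) \<Rightarrow> 'a set set \<Rightarrow> 'g set" where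
  "fix_blocks G \<phi> \<B> = (\<Inter>\<Delta> \<in> \<B>. {g \<in> carrier G. \<phi> g ` \<Delta> = \<Delta>})"


section \<open>q-cycle sets\<close>

text \<open>\<open>x \<cdot> y\<close> is the first operation, \<open>x \<Colon> y\<close> the one usually written \<open>x : y\<close>.\<close>

record 'a qcs = "'a partial_object" +
  qdot :: "'a \<Rightarrow> 'a \<Rightarrow> 'a" (infixl \<open>\<cdot>\<index>\<close> 70)
  qcolon :: "'a \<Rightarrow> 'a \<Rightarrow> 'a" (infixl \<open>\<Colon>\<index>\<close> 70)

locale q_cycle_set =
  fixes X :: "'a qcs" (structure)
  assumes nonempty: "carrier X \<noteq> {}"
    and dot_closed: "\<lbrakk> x \<in> carrier X; y \<in> carrier X \<rbrakk> \<Longrightarrow> x \<cdot> y \<in> carrier X"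
    and colon_closed: "\<lbrakk> x \<in> carrier X; y \<in> carrier X \<rbrakk> \<Longrightarrow> x \<Colon> y \<in> carrier X"
    and dot_bij: "x \<in> carrier X \<Longrightarrow> bij_betw (\<lambda>y. x \<cdot> y) (carrier X) (carrier X)"
    and dot_dot: "\<lbrakk> x \<in> carrier X; y \<in> carrier X; z \<in> carrier X \<rbrakk> \<Longrightarrow>
      (x \<cdot> y) \<cdot> (x \<cdot> z) = (y \<Colon> x) \<cdot> (y \<cdot> z)"
    and colon_colon: "\<lbrakk> x \<in> carrier X; y \<in> carrier X; z \<in> carrier X \<rbrakk> \<Longrightarrow>
      (x \<Colon> y) \<Colon> (x \<Colon> z) = (y \<cdot> x) \<Colon> (y \<Colon> z)"
    and dot_colon: "\<lbrakk> x \<in> carrier X; y \<in> carrier X; z \<in> carrier X \<rbrakk> \<Longrightarrow>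
      (x \<cdot> y) \<Colon> (x \<cdot> z) = (y \<Colon> x) \<cdot> (y \<Colon> z)"

locale finite_q_cycle_set = q_cycle_set +
  assumes finite_carrier: "finite (carrier X)"

locale regular_q_cycle_set = q_cycle_set +
  assumes colon_bij: "x \<in> carrier X \<Longrightarrow> bij_betw (\<lambda>y. x \<Colon> y) (carrier X) (carrier X)"

text \<open>The restrictions make \<open>\<sigma>\<^sub>x\<close> and \<open>\<delta>\<^sub>x\<close> elements of \<^term>\<open>BijGroup (carrier X)\<close>,
  the symmetric group on the carrier, whose elements are extensional functions.\<close>

definition qsigma :: "'a qcs \<Rightarrow> 'a \<Rightarrow> 'a \<Rightarrow> 'a" where
  "qsigma X x = (\<lambda>y \<in> carrier X. x \<cdot>\<^bsub>X\<^esub> y)"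

definition qdelta :: "'a qcs \<Rightarrow> 'a \<Rightarrow> 'a \<Rightarrow> 'a" where
  "qdelta X x = (\<lambda>y \<in> carrier X. x \<Colon>\<^bsub>X\<^esub> y)"

definition perm_group :: "'a qcs \<Rightarrow> ('a \<Rightarrow> 'a) monoid" where
  "perm_group X = (BijGroup (carrier X))
     \<lparr>carrier := generate (BijGroup (carrier X))
        (qsigma X ` carrier X \<union> qdelta X ` carrier X)\<rparr>"

definition Dis :: "'a qcs \<Rightarrow> 'a set \<Rightarrow> ('a \<Rightarrow> 'a) set" where
  "Dis X \<Delta> = (let S = BijGroup (carrier X) in
     generate S
       ({(inv\<^bsub>S\<^esub> (qsigma X x)) \<otimes>\<^bsub>S\<^esub> qsigma X y | x y. x \<in> \<Delta> \<and> y \<in> \<Delta>} \<union>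
        {(inv\<^bsub>S\<^esub> (qdelta X x)) \<otimes>\<^bsub>S\<^esub> qdelta X y | x y. x \<in> \<Delta> \<and> y \<in> \<Delta>}))"

text \<open>\<^term>\<open>perm_group X\<close> consists of permutations and acts tautologically,
  i.e. through \<open>\<lambda>g. g\<close>.\<close>

definition indecomposable :: "'a qcs \<Rightarrow> bool" where
  "indecomposable X \<longleftrightarrow>
     regular_q_cycle_set X \<and> transitive_action (perm_group X) (carrier X) (\<lambda>g. g)"

definition primitive_qcs :: "'a qcs \<Rightarrow> bool" where
  "primitive_qcs X \<longleftrightarrow>
     regular_q_cycle_set X \<and> primitive_action (perm_group X) (carrier X) (\<lambda>g. g)"


section \<open>Epimorphisms and primitive level\<close>

definition qcs_hom :: "'a qcs \<Rightarrow> 'b qcs \<Rightarrow> ('a \<Rightarrow> 'b) set" where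
  "qcs_hom X Y = {p \<in> carrier X \<rightarrow> carrier Y. \<forall>x \<in> carrier X. \<forall>y \<in> carrier X.
     p (x \<cdot>\<^bsub>X\<^esub> y) = p x \<cdot>\<^bsub>Y\<^esub> p y \<and> p (x \<Colon>\<^bsub>X\<^esub> y) = p x \<Colon>\<^bsub>Y\<^esub> p y}"

definition qcs_epi :: "'a qcs \<Rightarrow> 'b qcs \<Rightarrow> ('a \<Rightarrow> 'b) set" where
  "qcs_epi X Y = {p \<in> qcs_hom X Y. p ` carrier X = carrier Y}"

text \<open>All members of a chain have carriers in one type \<open>'a\<close>. This loses no generality: the
  cardinalities do not increase along the chain, so every member is isomorphic to a q-cycle
  set whose carrier is a subset of that of \<open>X\<close>.\<close>

definition primitive_chain :: "'a qcs \<Rightarrow> nat \<Rightarrow> (nat \<Rightarrow> 'a qcs) \<Rightarrow> bool" where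
  "primitive_chain X k Y \<longleftrightarrow>
     Y 1 = X \<and>
     (\<forall>i \<in> {1..k}. finite_q_cycle_set (Y i)) \<and>
     (\<forall>i \<in> {1..k - 1}.
        card (carrier (Y i)) > card (carrier (Y (i + 1))) \<and>
        card (carrier (Y (i + 1))) > 1 \<and>
        qcs_epi (Y i) (Y (i + 1)) \<noteq> {}) \<and>
     primitive_qcs (Y k)"

definition has_primitive_level :: "'a qcs \<Rightarrow> nat \<Rightarrow> bool" where
  "has_primitive_level X k \<longleftrightarrow>
     1 \<le> k \<and> (\<exists>Y. primitive_chain X k Y) \<and>
     (\<forall>l \<ge> 1. (\<exists>Y. primitive_chain X l Y) \<longrightarrow> l \<le> k)"

definition finite_primitive_level :: "'a qcs \<Rightarrow> bool" where
  "finite_primitive_level X \<longleftrightarrow> (\<exists>k. has_primitive_level X k)"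

end

theory Submission
  imports Defs
begin

text \<open>The cardinalities strictly decrease along a chain of epimorphisms, so the lengths of the
  chains that start at \<open>X\<close> are bounded by \<open>|X|\<close>, and \<open>X\<close> has finite primitive level as soon as
  it has one chain that ends in a primitive q-cycle set. Composing the epimorphisms of a chain,
  this says that \<open>X\<close> is primitive itself or has a primitive quotient \<open>P\<close> with
  \<open>1 < |P| < |X|\<close>. It remains to match such quotients with the blocks systems of the theorem.

  An epimorphism \<open>p : X \<rightarrow> P\<close> carries \<open>\<sigma>\<^sub>x\<close> to \<open>\<sigma>\<^bsub>p x\<^esub>\<close> and \<open>\<delta>\<^sub>x\<close> to \<open>\<delta>\<^bsub>p x\<^esub>\<close>, hence
  is equivariant for the permutation groups in both directions: every element of one group
  corresponds to an element of the other (\<open>epi_factor_action\<close>). For an equivariant surjection out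
  of a transitive action, taking images and preimages relates the blocks downstairs to the blocks
  upstairs that contain a fibre. So the action downstairs is primitive exactly when the fibres,
  which are blocks, are maximal ones (\<open>primitive_iff_maximal_fibre\<close>).

  The \<open>Dis\<close> condition singles out the blocks systems that are the fibres of an epimorphism. The
  fibres of \<open>p\<close> satisfy it, since \<open>p x = p y\<close> makes \<open>\<sigma>\<^sub>x\<close> and \<open>\<sigma>\<^sub>y\<close> agree after \<open>p\<close>
  (\<open>primitive_quotient_imp_maximal_system\<close>). Conversely, if \<open>x\<close> and \<open>x'\<close> share a block, then
  \<open>\<sigma>\<^bsub>x'\<^esub> = \<sigma>\<^sub>x \<circ> e\<close> with \<open>e \<in> Dis(X, \<Delta>)\<close> preserving every block, so the block of \<open>x \<cdot> y\<close> depends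
  only on the blocks of \<open>x\<close> and \<open>y\<close>. The same holds for \<open>x : y\<close>, and the blocks themselves form
  a q-cycle set (\<open>maximal_system_imp_primitive_quotient\<close>).\<close>

section \<open>Equivariant surjections and blocks\<close>

definition fibre :: "'a set \<Rightarrow> ('a \<Rightarrow> 'b) \<Rightarrow> 'a \<Rightarrow> 'a set" where
  "fibre E p x = {y \<in> E. p y = p x}"

text \<open>The set \<open>k g \<Delta>\<close> is the translate by \<open>g\<close> of \<open>(inv g \<otimes> k \<otimes> g) \<Delta>\<close>, which is \<open>\<Delta>\<close> or disjoint from
  it.\<close>
lemma (in group_action) block_translate:
  assumes "is_block G E \<phi> \<Delta>" and g: "g \<in> carrier G"
  shows "is_block G E \<phi> (\<phi> g ` \<Delta>)"
proof -
  interpret group G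
    using group_hom group_hom.axioms(1) by auto
  have \<Delta>: "\<Delta> \<subseteq> E" "\<Delta> \<noteq> E" "2 \<le> card \<Delta>"
    and stable: "\<And>k. k \<in> carrier G \<Longrightarrow> \<phi> k ` \<Delta> = \<Delta> \<or> \<phi> k ` \<Delta> \<inter> \<Delta> = {}"
    using assms(1) unfolding is_block_def by auto
  have inj: "inj_on (\<phi> g) E" and surj: "\<phi> g ` E = E"
    using inj_prop surj_prop g by auto
  have "\<phi> k ` \<phi> g ` \<Delta> = \<phi> g ` \<Delta> \<or> \<phi> k ` \<phi> g ` \<Delta> \<inter> \<phi> g ` \<Delta> = {}"
    if k: "k \<in> carrier G" for k
  proof -
    define l where "l = inv g \<otimes> (k \<otimes> g)"
    have l: "l \<in> carrier G" "g \<otimes> l = k \<otimes> g"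
      using g k by (auto simp: l_def m_assoc[symmetric])
    have lE: "\<phi> l ` \<Delta> \<subseteq> E"
      using \<Delta>(1) surj_prop[OF l(1)] by blast
    have "\<phi> k (\<phi> g x) = \<phi> g (\<phi> l x)" if "x \<in> \<Delta>" for x
      using composition_rule[of x g l] composition_rule[of x k g] l g k that \<Delta>(1) by auto
    then have "\<phi> k ` \<phi> g ` \<Delta> = \<phi> g ` \<phi> l ` \<Delta>"
      by (auto simp: image_image)
    moreover have "\<phi> g ` \<phi> l ` \<Delta> \<inter> \<phi> g ` \<Delta> = \<phi> g ` (\<phi> l ` \<Delta> \<inter> \<Delta>)"
      using inj_on_image_Int[OF inj lE \<Delta>(1)] by simp
    ultimately show ?thesis
      using stable[OF l(1)] by auto
  qed
  moreover have "\<phi> g ` \<Delta> \<subseteq> E"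
    using \<Delta>(1) surj by blast
  moreover have "\<phi> g ` \<Delta> \<noteq> E"
    using \<Delta>(1,2) inj surj by (metis inj_on_image_eq_iff order_refl)
  moreover have "card (\<phi> g ` \<Delta>) = card \<Delta>"
    using card_image inj_on_subset[OF inj \<Delta>(1)] by blast
  ultimately show ?thesis
    using \<Delta>(3) unfolding is_block_def by auto
qed

text \<open>The two lifting conditions replace a homomorphism \<open>G \<rightarrow> H\<close>. An element \<open>h\<close> is determined by
  \<open>g\<close> only as a permutation of \<open>F\<close>, and blocks see nothing but these permutations.\<close>
locale factor_action = E: group_action G E \<phi> + F: group_action H F \<psi>
  for G (structure) and E and \<phi> and H (structure) and F and \<psi> +
  fixes p
  assumes surj: "p ` E = F"
    and lift: "h \<in> carrier H \<Longrightarrow> \<exists>g \<in> carrier G. \<forall>x \<in> E. p (\<phi> g x) = \<psi> h (p x)"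
    and descend: "g \<in> carrier G \<Longrightarrow> \<exists>h \<in> carrier H. \<forall>x \<in> E. p (\<phi> g x) = \<psi> h (p x)"
begin

lemma proj_in: "x \<in> E \<Longrightarrow> p x \<in> F"
  using surj by blast

lemma act_in: "g \<in> carrier G \<Longrightarrow> x \<in> E \<Longrightarrow> \<phi> g x \<in> E"
  using E.surj_prop by blast

lemma proj_act_eq_iff:
  assumes "g \<in> carrier G" "x \<in> E" "y \<in> E"
  shows "p (\<phi> g x) = p (\<phi> g y) \<longleftrightarrow> p x = p y"
proof -
  obtain h where "h \<in> carrier H" and h: "\<forall>x \<in> E. p (\<phi> g x) = \<psi> h (p x)"
    using descend[OF assms(1)] by blast
  then have "inj_on (\<psi> h) F"
    using F.inj_prop by blast
  then show ?thesis
    using h assms(2,3) proj_in by (auto dest: inj_onD)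
qed

lemma image_fibre:
  assumes "g \<in> carrier G" "x \<in> E"
  shows "\<phi> g ` fibre E p x = fibre E p (\<phi> g x)"
proof
  show "\<phi> g ` fibre E p x \<subseteq> fibre E p (\<phi> g x)"
    using assms by (auto simp: fibre_def act_in proj_act_eq_iff)
  show "fibre E p (\<phi> g x) \<subseteq> \<phi> g ` fibre E p x"
  proof
    fix z assume z: "z \<in> fibre E p (\<phi> g x)"
    then obtain y where "y \<in> E" "z = \<phi> g y"
      using E.surj_prop[OF assms(1)] by (auto simp: fibre_def)
    with z assms show "z \<in> \<phi> g ` fibre E p x"
      by (auto simp: fibre_def proj_act_eq_iff)
  qed
qed

lemma transitive_factor:
  assumes "transitive_action G E \<phi>"
  shows "transitive_action H F \<psi>"
proof (unfold_locales)
  fix u v assume "u \<in> F" "v \<in> F"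
  then obtain x y where xy: "x \<in> E" "y \<in> E" "u = p x" "v = p y"
    using surj by blast
  then obtain g where g: "g \<in> carrier G" "\<phi> g x = y"
    using transitive_action.unique_orbit[OF assms] by blast
  then show "\<exists>h \<in> carrier H. \<psi> h u = v"
    using descend[of g] xy by metis
qed

text \<open>If \<open>g\<close> corresponds to \<open>h\<close>, then \<open>g\<close> moves the preimage of \<open>\<Delta>\<close> to the preimage of \<open>h \<Delta>\<close>.
  Finiteness of \<open>E\<close> excludes an infinite preimage, whose \<^const>\<open>card\<close> would be 0.\<close>
lemma block_preimage:
  assumes fin: "finite E" and "is_block H F \<psi> \<Delta>"
  shows "is_block G E \<phi> {x \<in> E. p x \<in> \<Delta>}" (is "is_block G E \<phi> ?P")
proof -
  have \<Delta>: "\<Delta> \<subseteq> F" "\<Delta> \<noteq> F" "2 \<le> card \<Delta>"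
    and stable: "\<And>h. h \<in> carrier H \<Longrightarrow> \<psi> h ` \<Delta> = \<Delta> \<or> \<psi> h ` \<Delta> \<inter> \<Delta> = {}"
    using assms(2) unfolding is_block_def by auto
  have image: "p ` ?P = \<Delta>"
    using \<Delta>(1) surj by blast
  have "\<phi> g ` ?P = ?P \<or> \<phi> g ` ?P \<inter> ?P = {}" if g: "g \<in> carrier G" for g
  proof -
    obtain h where h: "h \<in> carrier H" "\<forall>x \<in> E. p (\<phi> g x) = \<psi> h (p x)"
      using descend[OF g] by blast
    consider "\<psi> h ` \<Delta> = \<Delta>" | "\<psi> h ` \<Delta> \<inter> \<Delta> = {}"
      using stable[OF h(1)] by blast
    then show ?thesis
    proof cases
      case 1
      have "\<psi> h u \<in> \<Delta> \<longleftrightarrow> u \<in> \<Delta>" if "u \<in> F" for u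
        using 1 that \<Delta>(1) F.inj_prop[OF h(1)] by (metis inj_on_image_mem_iff)
      then have mem: "p (\<phi> g x) \<in> \<Delta> \<longleftrightarrow> p x \<in> \<Delta>" if "x \<in> E" for x
        using h(2) that proj_in by simp
      have "?P \<subseteq> \<phi> g ` ?P"
      proof
        fix y assume y: "y \<in> ?P"
        then obtain x where "x \<in> E" "y = \<phi> g x"
          using E.surj_prop[OF g] by blast
        with y mem show "y \<in> \<phi> g ` ?P" by auto
      qed
      moreover have "\<phi> g ` ?P \<subseteq> ?P"
        using mem act_in[OF g] by auto
      ultimately show ?thesis by blast
    next
      case 2
      then show ?thesis using h(2) by auto
    qed
  qed
  moreover have "?P \<noteq> E"
    using image \<Delta>(2) surj by metis
  moreover have "2 \<le> card ?P"
    using \<Delta>(3) card_image_le[of ?P p] fin image by simp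
  ultimately show ?thesis
    unfolding is_block_def by auto
qed

text \<open>Disjoint sets can have overlapping images. Saturation under the fibres prevents this for
  \<open>g \<Delta>\<close> and \<open>\<Delta>\<close>.\<close>
lemma block_image:
  assumes "is_block G E \<phi> \<Delta>" "2 \<le> card (p ` \<Delta>)"
    and saturated: "\<And>x. x \<in> \<Delta> \<Longrightarrow> fibre E p x \<subseteq> \<Delta>"
  shows "is_block H F \<psi> (p ` \<Delta>)"
proof -
  have \<Delta>: "\<Delta> \<subseteq> E" "\<Delta> \<noteq> E"
    and stable: "\<And>g. g \<in> carrier G \<Longrightarrow> \<phi> g ` \<Delta> = \<Delta> \<or> \<phi> g ` \<Delta> \<inter> \<Delta> = {}"
    using assms(1) unfolding is_block_def by auto
  have mem: "x \<in> \<Delta>" if "x \<in> E" "p x \<in> p ` \<Delta>" for x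
    using that saturated by (fastforce simp: fibre_def)
  have "\<psi> h ` p ` \<Delta> = p ` \<Delta> \<or> \<psi> h ` p ` \<Delta> \<inter> p ` \<Delta> = {}" if h: "h \<in> carrier H" for h
  proof -
    obtain g where g: "g \<in> carrier G" "\<forall>x \<in> E. p (\<phi> g x) = \<psi> h (p x)"
      using lift[OF h] by blast
    then have "\<psi> h ` p ` \<Delta> = p ` \<phi> g ` \<Delta>"
      using \<Delta>(1) by (force simp: image_image)
    moreover have "p ` \<phi> g ` \<Delta> \<inter> p ` \<Delta> = {}" if "\<phi> g ` \<Delta> \<inter> \<Delta> = {}"
      using mem act_in[OF g(1)] \<Delta>(1) that by blast
    ultimately show ?thesis
      using stable[OF g(1)] by metis
  qed
  moreover have "p ` \<Delta> \<noteq> F"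
    using mem \<Delta> surj by blast
  ultimately show ?thesis
    using assms(2) \<Delta>(1) surj unfolding is_block_def by auto
qed

text \<open>The group permutes the fibres, so by transitivity they all have the same size. This size is not
  1, as \<open>p\<close> would then be injective, against \<open>|F| < |E|\<close>.\<close>
lemma fibre_is_block:
  assumes trans: "transitive_action G E \<phi>" and fin: "finite E"
    and card: "1 < card F" "card F < card E" and x: "x \<in> E"
  shows "is_block G E \<phi> (fibre E p x)"
proof -
  have x_in: "x \<in> fibre E p x"
    using x by (simp add: fibre_def)
  have sub: "fibre E p x \<subseteq> E"
    by (auto simp: fibre_def)
  have "fibre E p x \<noteq> E"
  proof
    assume "fibre E p x = E"
    then have "p ` E \<subseteq> {p x}"
      by (auto simp: fibre_def)
    then have "card F \<le> 1"
      using surj card_mono[of "{p x}" "p ` E"] by simp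
    with card(1) show False by simp
  qed
  moreover have "2 \<le> card (fibre E p x)"
  proof (rule ccontr)
    assume "\<not> ?thesis"
    moreover have "card (fibre E p x) \<noteq> 0"
      using x_in finite_subset[OF sub fin] by auto
    ultimately have "card (fibre E p x) = 1"
      by simp
    then obtain z where "fibre E p x = {z}"
      by (rule card_1_singletonE)
    then have single: "fibre E p x = {x}"
      using x_in by auto
    have "inj_on p E"
    proof (rule inj_onI)
      fix y z assume yz: "y \<in> E" "z \<in> E" "p y = p z"
      obtain g where g: "g \<in> carrier G" "\<phi> g x = y"
        using transitive_action.unique_orbit[OF trans x yz(1)] by blast
      then have "fibre E p y = {y}"
        using image_fibre[OF g(1) x] single by simp
      then show "y = z"
        using yz by (auto simp: fibre_def)
    qed
    then show False
      using card_image[of p E] surj card(2) by simp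
  qed
  moreover have "\<phi> g ` fibre E p x = fibre E p x \<or> \<phi> g ` fibre E p x \<inter> fibre E p x = {}"
    if "g \<in> carrier G" for g
    using image_fibre[OF that x] by (auto simp: fibre_def)
  ultimately show ?thesis
    using sub unfolding is_block_def by blast
qed

text \<open>A block containing one fibre contains the fibre of each of its points \<open>z = g x\<close>: the element \<open>g\<close>
  fixes the block, because the block meets its translate in \<open>z\<close>. So the image of a block strictly
  above a fibre is a block of \<open>F\<close>. Conversely, a block of \<open>F\<close> can be translated to contain \<open>p x\<close>,
  and its preimage is then a block strictly above the fibre of \<open>x\<close>.\<close>
theorem primitive_iff_maximal_fibre:
  assumes trans: "transitive_action G E \<phi>" and fin: "finite E"
    and card: "1 < card F" "card F < card E" and x: "x \<in> E"
  shows "primitive_action H F \<psi> \<longleftrightarrow> maximal_block G E \<phi> (fibre E p x)"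
proof
  assume "primitive_action H F \<psi>"
  then have prim: "\<not> is_block H F \<psi> \<Gamma>" for \<Gamma>
    unfolding primitive_action_def imprimitive_action_def by blast
  have "fibre E p x = \<Delta>" if \<Delta>: "is_block G E \<phi> \<Delta>" "fibre E p x \<subseteq> \<Delta>" for \<Delta>
  proof (rule ccontr)
    assume "fibre E p x \<noteq> \<Delta>"
    with \<Delta>(2) obtain y where y: "y \<in> \<Delta>" "y \<notin> fibre E p x"
      by blast
    have x_in: "x \<in> \<Delta>"
      using \<Delta>(2) x by (auto simp: fibre_def)
    have sub: "\<Delta> \<subseteq> E"
      using \<Delta>(1) by (simp add: is_block_def)
    then have "p y \<noteq> p x"
      using y by (auto simp: fibre_def)
    then have "card {p x, p y} = 2"
      by simp
    then have "2 \<le> card (p ` \<Delta>)"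
      using card_mono[of "p ` \<Delta>" "{p x, p y}"] x_in y(1) finite_subset[OF sub fin] by simp
    moreover have "fibre E p z \<subseteq> \<Delta>" if z: "z \<in> \<Delta>" for z
    proof -
      obtain g where g: "g \<in> carrier G" "\<phi> g x = z"
        using transitive_action.unique_orbit[OF trans x, of z] z sub by blast
      then have "\<phi> g ` \<Delta> = \<Delta>"
        using \<Delta>(1) z x_in unfolding is_block_def by blast
      then show ?thesis
        using image_fibre[OF g(1) x] g(2) \<Delta>(2) by blast
    qed
    ultimately show False
      using block_image[OF \<Delta>(1)] prim by blast
  qed
  then show "maximal_block G E \<phi> (fibre E p x)"
    unfolding maximal_block_def using fibre_is_block[OF assms] by blast
next
  assume max: "maximal_block G E \<phi> (fibre E p x)"
  have trans': "transitive_action H F \<psi>"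
    using transitive_factor[OF trans] .
  have "\<not> is_block H F \<psi> \<Delta>" for \<Delta>
  proof
    assume \<Delta>: "is_block H F \<psi> \<Delta>"
    then have "\<Delta> \<subseteq> F" "\<Delta> \<noteq> {}"
      unfolding is_block_def by auto
    then obtain u where u: "u \<in> \<Delta>" "u \<in> F"
      by blast
    obtain h where h: "h \<in> carrier H" "\<psi> h u = p x"
      using transitive_action.unique_orbit[OF trans' u(2) proj_in[OF x]] by blast
    define \<Gamma> where "\<Gamma> = \<psi> h ` \<Delta>"
    have \<Gamma>: "is_block H F \<psi> \<Gamma>"
      unfolding \<Gamma>_def by (rule F.block_translate[OF \<Delta> h(1)])
    have "p x \<in> \<Gamma>"
      using u h unfolding \<Gamma>_def by force
    then have "fibre E p x \<subseteq> {y \<in> E. p y \<in> \<Gamma>}"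
      by (auto simp: fibre_def)
    moreover have "is_block G E \<phi> {y \<in> E. p y \<in> \<Gamma>}"
      by (rule block_preimage[OF fin \<Gamma>])
    moreover from this have "{y \<in> E. p y \<in> \<Gamma>} \<noteq> E"
      unfolding is_block_def by blast
    ultimately have eq: "fibre E p x = {y \<in> E. p y \<in> \<Gamma>}"
      using max unfolding maximal_block_def by blast
    have "\<Gamma> \<subseteq> {p x}"
    proof
      fix v assume v: "v \<in> \<Gamma>"
      then obtain y where "y \<in> E" "v = p y"
        using \<Gamma> surj unfolding is_block_def by blast
      with v eq show "v \<in> {p x}"
        by (auto simp: fibre_def)
    qed
    then have "card \<Gamma> \<le> 1"
      using card_mono[of "{p x}" \<Gamma>] by simp
    then show False
      using \<Gamma> unfolding is_block_def by simp
  qed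
  then show "primitive_action H F \<psi>"
    using trans' unfolding primitive_action_def imprimitive_action_def by blast
qed

end

section \<open>Epimorphisms and permutation groups\<close>

lemma carrier_BijGroup: "carrier (BijGroup S) = Bij S"
  by (simp add: BijGroup_def)

lemma one_BijGroup_apply: "x \<in> S \<Longrightarrow> \<one>\<^bsub>BijGroup S\<^esub> x = x"
  by (simp add: BijGroup_def)

lemma mult_BijGroup_apply:
  "f \<in> Bij S \<Longrightarrow> g \<in> Bij S \<Longrightarrow> x \<in> S \<Longrightarrow> (f \<otimes>\<^bsub>BijGroup S\<^esub> g) x = f (g x)"
  by (simp add: BijGroup_def compose_eq)

lemma Bij_apply_in: "f \<in> Bij S \<Longrightarrow> x \<in> S \<Longrightarrow> f x \<in> S"
  using Bij_imp_funcset by blast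

lemma inv_in_Bij: "f \<in> Bij S \<Longrightarrow> inv\<^bsub>BijGroup S\<^esub> f \<in> Bij S"
  using group.inv_closed[OF group_BijGroup, of f S] by (simp add: carrier_BijGroup)

lemma inv_BijGroup_cancel:
  assumes "f \<in> Bij S" "x \<in> S"
  shows "(inv\<^bsub>BijGroup S\<^esub> f) (f x) = x" and "f ((inv\<^bsub>BijGroup S\<^esub> f) x) = x"
  using assms Bij_apply_in[OF assms]
  by (auto simp: inv_BijGroup Bij_def bij_betw_def inv_into_f_f f_inv_into_f)

lemma generate_in_Bij: "A \<subseteq> Bij S \<Longrightarrow> g \<in> generate (BijGroup S) A \<Longrightarrow> g \<in> Bij S"
  using group.generate_in_carrier[OF group_BijGroup, of A S] by (simp add: carrier_BijGroup)

definition intertwines :: "('a \<Rightarrow> 'b) \<Rightarrow> 'a set \<Rightarrow> ('a \<Rightarrow> 'a) \<Rightarrow> ('b \<Rightarrow> 'b) \<Rightarrow> bool" where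
  "intertwines p E g h \<longleftrightarrow> (\<forall>x \<in> E. p (g x) = h (p x))"

lemma intertwines_one:
  "p ` E = F \<Longrightarrow> intertwines p E \<one>\<^bsub>BijGroup E\<^esub> \<one>\<^bsub>BijGroup F\<^esub>"
  by (auto simp: intertwines_def one_BijGroup_apply)

lemma intertwines_mult:
  assumes "p ` E = F" "g \<in> Bij E" "g' \<in> Bij E" "h \<in> Bij F" "h' \<in> Bij F"
    and "intertwines p E g h" "intertwines p E g' h'"
  shows "intertwines p E (g \<otimes>\<^bsub>BijGroup E\<^esub> g') (h \<otimes>\<^bsub>BijGroup F\<^esub> h')"
  using assms by (auto simp: intertwines_def mult_BijGroup_apply Bij_apply_in)

lemma intertwines_inv:
  assumes "p ` E = F" "g \<in> Bij E" "h \<in> Bij F" "intertwines p E g h"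
  shows "intertwines p E (inv\<^bsub>BijGroup E\<^esub> g) (inv\<^bsub>BijGroup F\<^esub> h)"
  unfolding intertwines_def
proof
  fix x assume x: "x \<in> E"
  define y where "y = (inv\<^bsub>BijGroup E\<^esub> g) x"
  have y: "y \<in> E" "g y = x"
    using assms(2) x by (auto simp: y_def Bij_apply_in inv_in_Bij inv_BijGroup_cancel)
  then have "p x = h (p y)"
    using assms(4) by (auto simp: intertwines_def)
  then have "(inv\<^bsub>BijGroup F\<^esub> h) (p x) = p y"
    using inv_BijGroup_cancel(1)[OF assms(3)] y(1) assms(1) by auto
  then show "p ((inv\<^bsub>BijGroup E\<^esub> g) x) = (inv\<^bsub>BijGroup F\<^esub> h) (p x)"
    by (simp add: y_def)
qed

text \<open>Intertwining is compatible with the group operations, so it passes from generators to the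
  generated groups, in both directions.\<close>
lemma generate_descend:
  assumes "g \<in> generate (BijGroup E) A"
    and surj: "p ` E = F" and A: "A \<subseteq> Bij E" and B: "B \<subseteq> Bij F"
    and gens: "\<And>a. a \<in> A \<Longrightarrow> \<exists>b \<in> B. intertwines p E a b"
  shows "\<exists>h \<in> generate (BijGroup F) B. intertwines p E g h"
  using assms(1)
proof induction
  case one
  then show ?case
    using intertwines_one[OF surj] generate.one by blast
next
  case (incl a)
  then show ?case
    using gens generate.incl by metis
next
  case (inv a)
  then obtain b where "b \<in> B" "intertwines p E a b"
    using gens by blast
  with inv show ?case
    using intertwines_inv[OF surj] generate.inv A B by (metis subsetD)
next
  case (eng g g')
  then obtain h h' where "h \<in> generate (BijGroup F) B" "h' \<in> generate (BijGroup F) B"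
    "intertwines p E g h" "intertwines p E g' h'"
    by blast
  with eng show ?case
    using intertwines_mult[OF surj] generate.eng generate_in_Bij[OF A] generate_in_Bij[OF B]
    by metis
qed

lemma generate_lift:
  assumes "h \<in> generate (BijGroup F) B"
    and surj: "p ` E = F" and A: "A \<subseteq> Bij E" and B: "B \<subseteq> Bij F"
    and gens: "\<And>b. b \<in> B \<Longrightarrow> \<exists>a \<in> A. intertwines p E a b"
  shows "\<exists>g \<in> generate (BijGroup E) A. intertwines p E g h"
  using assms(1)
proof induction
  case one
  then show ?case
    using intertwines_one[OF surj] generate.one by blast
next
  case (incl b)
  then show ?case
    using gens generate.incl by metis
next
  case (inv b)
  then obtain a where "a \<in> A" "intertwines p E a b"
    using gens by blast
  with inv show ?case
    using intertwines_inv[OF surj] generate.inv A B by (metis subsetD)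
next
  case (eng h h')
  then obtain g g' where "g \<in> generate (BijGroup E) A" "g' \<in> generate (BijGroup E) A"
    "intertwines p E g h" "intertwines p E g' h'"
    by blast
  with eng show ?case
    using intertwines_mult[OF surj] generate.eng generate_in_Bij[OF A] generate_in_Bij[OF B]
    by metis
qed

definition perm_gens :: "'a qcs \<Rightarrow> ('a \<Rightarrow> 'a) set" where
  "perm_gens X = qsigma X ` carrier X \<union> qdelta X ` carrier X"

lemma carrier_perm_group: "carrier (perm_group X) = generate (BijGroup (carrier X)) (perm_gens X)"
  by (simp add: perm_group_def perm_gens_def)

context regular_q_cycle_set
begin

lemma qsigma_Bij: "x \<in> carrier X \<Longrightarrow> qsigma X x \<in> Bij (carrier X)"
  using dot_bij by (auto simp: qsigma_def Bij_def cong: bij_betw_cong)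

lemma qdelta_Bij: "x \<in> carrier X \<Longrightarrow> qdelta X x \<in> Bij (carrier X)"
  using colon_bij by (auto simp: qdelta_def Bij_def cong: bij_betw_cong)

lemma perm_gens_Bij: "perm_gens X \<subseteq> Bij (carrier X)"
  using qsigma_Bij qdelta_Bij by (auto simp: perm_gens_def)

lemma qsigma_in_perm_group: "x \<in> carrier X \<Longrightarrow> qsigma X x \<in> carrier (perm_group X)"
  and qdelta_in_perm_group: "x \<in> carrier X \<Longrightarrow> qdelta X x \<in> carrier (perm_group X)"
  by (auto simp: carrier_perm_group perm_gens_def intro: generate.incl)

lemma subgroup_perm_group: "subgroup (carrier (perm_group X)) (BijGroup (carrier X))"
  unfolding carrier_perm_group
  by (rule group.generate_is_subgroup[OF group_BijGroup])
    (simp add: carrier_BijGroup perm_gens_Bij)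

lemma group_action_perm_group: "group_action (perm_group X) (carrier X) (\<lambda>g. g)"
proof -
  have eq: "perm_group X = (BijGroup (carrier X))\<lparr>carrier := carrier (perm_group X)\<rparr>"
    by (simp add: perm_group_def)
  have "group (perm_group X)"
    using group.subgroup_imp_group[OF group_BijGroup subgroup_perm_group] eq by simp
  moreover have "(\<lambda>g. g) \<in> hom (perm_group X) (BijGroup (carrier X))"
    using subgroup.subset[OF subgroup_perm_group] by (auto simp: hom_def perm_group_def)
  ultimately show ?thesis
    by (simp add: group_action_def group_hom_def group_hom_axioms_def group_BijGroup)
qed

end

lemma epi_apply:
  assumes "p \<in> qcs_epi X Y" "x \<in> carrier X" "y \<in> carrier X"
  shows "p (x \<cdot>\<^bsub>X\<^esub> y) = p x \<cdot>\<^bsub>Y\<^esub> p y" and "p (x \<Colon>\<^bsub>X\<^esub> y) = p x \<Colon>\<^bsub>Y\<^esub> p y"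
  using assms by (auto simp: qcs_epi_def qcs_hom_def)

lemma epi_image: "p \<in> qcs_epi X Y \<Longrightarrow> p ` carrier X = carrier Y"
  by (simp add: qcs_epi_def)

lemma epi_comp:
  assumes "p \<in> qcs_epi X Y" "q \<in> qcs_epi Y Z"
  shows "q \<circ> p \<in> qcs_epi X Z"
proof -
  have p: "p x \<in> carrier Y" if "x \<in> carrier X" for x
    using epi_image[OF assms(1)] that by blast
  have "(q \<circ> p) ` carrier X = carrier Z"
    using epi_image[OF assms(1)] epi_image[OF assms(2)] by (metis image_comp)
  then show ?thesis
    using p epi_apply[OF assms(1)] epi_apply[OF assms(2)]
    by (auto simp: qcs_epi_def qcs_hom_def)
qed

lemma epi_factor_action:
  fixes X :: "'a qcs" and P :: "'b qcs"
  assumes "regular_q_cycle_set X" "regular_q_cycle_set P" and p: "p \<in> qcs_epi X P"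
  shows "factor_action (perm_group X) (carrier X) (\<lambda>g. g) (perm_group P) (carrier P) (\<lambda>g. g) p"
proof -
  interpret X: regular_q_cycle_set X by fact
  interpret P: regular_q_cycle_set P by fact
  have image: "p ` carrier X = carrier P"
    using epi_image[OF p] .
  have sigma: "intertwines p (carrier X) (qsigma X x) (qsigma P (p x))"
    and delta: "intertwines p (carrier X) (qdelta X x) (qdelta P (p x))"
    if "x \<in> carrier X" for x
    using that image epi_apply[OF p that] by (auto simp: intertwines_def qsigma_def qdelta_def)
  have down: "\<exists>b \<in> perm_gens P. intertwines p (carrier X) a b" if "a \<in> perm_gens X" for a
    using that sigma delta image by (fastforce simp: perm_gens_def)
  have up: "\<exists>a \<in> perm_gens X. intertwines p (carrier X) a b" if "b \<in> perm_gens P" for b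
    using that sigma delta image[symmetric] by (fastforce simp: perm_gens_def)
  show ?thesis
    unfolding factor_action_def factor_action_axioms_def
    using X.group_action_perm_group P.group_action_perm_group image
      generate_descend[OF _ image X.perm_gens_Bij P.perm_gens_Bij down]
      generate_lift[OF _ image X.perm_gens_Bij P.perm_gens_Bij up]
    by (simp add: carrier_perm_group intertwines_def)
qed


section \<open>Quotients and maximal blocks systems\<close>

text \<open>The quotient of \<open>X\<close> by the kernel of \<open>p\<close>, realised on the values of \<open>p\<close>. When \<open>p\<close> picks a
  representative of each class, the carrier stays in the type of \<open>X\<close>.\<close>
definition image_qcs :: "'a qcs \<Rightarrow> ('a \<Rightarrow> 'b) \<Rightarrow> 'b qcs" where
  "image_qcs X p =
    \<lparr>carrier = p ` carrier X,
     qdot = (\<lambda>u v. p (inv_into (carrier X) p u \<cdot>\<^bsub>X\<^esub> inv_into (carrier X) p v)),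
     qcolon = (\<lambda>u v. p (inv_into (carrier X) p u \<Colon>\<^bsub>X\<^esub> inv_into (carrier X) p v))\<rparr>"

text \<open>A congruence carries the identities over to the quotient, but not the injectivity of \<open>\<sigma>\<^sub>x\<close> and
  \<open>\<delta>\<^sub>x\<close>. The induced maps are surjective, and finiteness makes them bijective.\<close>
lemma image_qcs_congruence:
  fixes X :: "'a qcs" and p :: "'a \<Rightarrow> 'b"
  assumes "finite_q_cycle_set X" "regular_q_cycle_set X"
    and cong: "\<And>x x' y y'. \<lbrakk>x \<in> carrier X; x' \<in> carrier X; y \<in> carrier X; y' \<in> carrier X;
      p x = p x'; p y = p y'\<rbrakk> \<Longrightarrow>
      p (x \<cdot>\<^bsub>X\<^esub> y) = p (x' \<cdot>\<^bsub>X\<^esub> y') \<and> p (x \<Colon>\<^bsub>X\<^esub> y) = p (x' \<Colon>\<^bsub>X\<^esub> y')"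
  shows image_qcs_epi: "p \<in> qcs_epi X (image_qcs X p)"
    and regular_image_qcs: "regular_q_cycle_set (image_qcs X p)"
proof -
  interpret finite_q_cycle_set X by fact
  interpret regular_q_cycle_set X by fact
  let ?P = "image_qcs X p" and ?s = "inv_into (carrier X) p"
  have s: "?s (p x) \<in> carrier X" "p (?s (p x)) = p x" if "x \<in> carrier X" for x
    using that by (auto intro: inv_into_into f_inv_into_f)
  have C: "carrier ?P = p ` carrier X"
    by (simp add: image_qcs_def)
  have ops: "p x \<cdot>\<^bsub>?P\<^esub> p y = p (x \<cdot>\<^bsub>X\<^esub> y)" "p x \<Colon>\<^bsub>?P\<^esub> p y = p (x \<Colon>\<^bsub>X\<^esub> y)"
    if "x \<in> carrier X" "y \<in> carrier X" for x y
    using cong[of "?s (p x)" x "?s (p y)" y] s that by (simp_all add: image_qcs_def)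
  show "p \<in> qcs_epi X ?P"
    by (auto simp: qcs_epi_def qcs_hom_def C ops)
  have bij: "bij_betw f (p ` carrier X) (p ` carrier X)"
    if "f ` p ` carrier X = p ` carrier X" for f
    using that finite_carrier by (simp add: bij_betw_def eq_card_imp_inj_on)
  have onto: "(\<lambda>v. p x \<cdot>\<^bsub>?P\<^esub> v) ` p ` carrier X = p ` carrier X"
    "(\<lambda>v. p x \<Colon>\<^bsub>?P\<^esub> v) ` p ` carrier X = p ` carrier X" if x: "x \<in> carrier X" for x
  proof -
    have "(\<lambda>v. p x \<cdot>\<^bsub>?P\<^esub> v) ` p ` carrier X = p ` (\<lambda>y. x \<cdot>\<^bsub>X\<^esub> y) ` carrier X"
      using x by (auto simp: ops image_image)
    then show "(\<lambda>v. p x \<cdot>\<^bsub>?P\<^esub> v) ` p ` carrier X = p ` carrier X"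
      using dot_bij[OF x] by (simp add: bij_betw_def)
    have "(\<lambda>v. p x \<Colon>\<^bsub>?P\<^esub> v) ` p ` carrier X = p ` (\<lambda>y. x \<Colon>\<^bsub>X\<^esub> y) ` carrier X"
      using x by (auto simp: ops image_image)
    then show "(\<lambda>v. p x \<Colon>\<^bsub>?P\<^esub> v) ` p ` carrier X = p ` carrier X"
      using colon_bij[OF x] by (simp add: bij_betw_def)
  qed
  show "regular_q_cycle_set ?P"
  proof (unfold_locales, unfold C)
    show "p ` carrier X \<noteq> {}"
      using nonempty by simp
  qed (auto simp: ops dot_closed colon_closed dot_dot colon_colon dot_colon intro: bij[OF onto(1)] bij[OF onto(2)])
qed

lemma (in transitive_action) blocks_system_props:
  assumes "imprimitive_blocks_system G E \<phi> \<B>"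
  shows blocks_system_block: "D \<in> \<B> \<Longrightarrow> is_block G E \<phi> D"
    and blocks_system_image: "g \<in> carrier G \<Longrightarrow> D \<in> \<B> \<Longrightarrow> \<phi> g ` D \<in> \<B>"
    and blocks_system_disjoint: "D \<in> \<B> \<Longrightarrow> D' \<in> \<B> \<Longrightarrow> x \<in> D \<Longrightarrow> x \<in> D' \<Longrightarrow> D = D'"
    and blocks_system_cover: "x \<in> E \<Longrightarrow> \<exists>D \<in> \<B>. x \<in> D"
proof -
  interpret group G
    using group_hom group_hom.axioms(1) by auto
  obtain \<Delta> where \<Delta>: "is_block G E \<phi> \<Delta>" and B: "\<B> = (\<lambda>g. \<phi> g ` \<Delta>) ` carrier G"
    using assms unfolding imprimitive_blocks_system_def by blast
  have \<Delta>E: "\<Delta> \<subseteq> E" "\<Delta> \<noteq> {}"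
    using \<Delta> by (auto simp: is_block_def)
  have comp: "\<phi> g ` \<phi> k ` \<Delta> = \<phi> (g \<otimes> k) ` \<Delta>" if "g \<in> carrier G" "k \<in> carrier G" for g k
    unfolding image_image using composition_rule that \<Delta>E by (intro image_cong) auto
  show block: "is_block G E \<phi> D" if "D \<in> \<B>" for D
    using that block_translate[OF \<Delta>] by (auto simp: B)
  show "\<phi> g ` D \<in> \<B>" if "g \<in> carrier G" "D \<in> \<B>" for g D
    using that comp by (auto simp: B)
  show "D = D'" if D: "D \<in> \<B>" "D' \<in> \<B>" and x: "x \<in> D" "x \<in> D'" for D D' x
  proof -
    obtain g g' where g: "g \<in> carrier G" "D = \<phi> g ` \<Delta>" "g' \<in> carrier G" "D' = \<phi> g' ` \<Delta>"
      using D by (auto simp: B)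
    have "g' \<otimes> inv g \<otimes> g = g'"
      using g by (simp add: m_assoc)
    then have "D' = \<phi> (g' \<otimes> inv g) ` D"
      using comp[of "g' \<otimes> inv g" g] g by simp
    moreover have "g' \<otimes> inv g \<in> carrier G"
      using g by simp
    ultimately show "D = D'"
      using block[OF D(1)] x unfolding is_block_def by blast
  qed
  show "\<exists>D \<in> \<B>. x \<in> D" if x: "x \<in> E"
  proof -
    obtain y where y: "y \<in> \<Delta>"
      using \<Delta>E by blast
    then obtain g where "g \<in> carrier G" "\<phi> g y = x"
      using unique_orbit x \<Delta>E by blast
    then show ?thesis
      using y by (auto simp: B)
  qed
qed

text \<open>Every blocks system is the system of fibres of a map with values in the set acted upon.\<close>
lemma (in transitive_action) blocks_system_representatives:
  assumes B: "imprimitive_blocks_system G E \<phi> \<B>"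
  obtains r where "\<And>D. D \<in> \<B> \<Longrightarrow> r ` D \<subseteq> D"
    and "\<And>D x. D \<in> \<B> \<Longrightarrow> x \<in> D \<Longrightarrow> fibre E r x = D"
proof -
  define r where "r x = (SOME y. \<exists>D \<in> \<B>. x \<in> D \<and> y \<in> D)" for x
  have r_in: "r x \<in> D" if "D \<in> \<B>" "x \<in> D" for D x
  proof -
    have "\<exists>D \<in> \<B>. x \<in> D \<and> r x \<in> D"
      unfolding r_def by (rule someI_ex) (use that in blast)
    then show ?thesis
      using blocks_system_disjoint[OF B] that by blast
  qed
  have r_eq: "r x = r y" if "D \<in> \<B>" "x \<in> D" "y \<in> D" for D x y
  proof -
    have "(\<exists>D \<in> \<B>. x \<in> D \<and> z \<in> D) \<longleftrightarrow> (\<exists>D \<in> \<B>. y \<in> D \<and> z \<in> D)" for z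
      using blocks_system_disjoint[OF B] that by blast
    then show ?thesis
      by (simp add: r_def)
  qed
  have "fibre E r x = D" if D: "D \<in> \<B>" "x \<in> D" for D x
  proof
    have "D \<subseteq> E"
      using blocks_system_block[OF B D(1)] by (simp add: is_block_def)
    then show "D \<subseteq> fibre E r x"
      using r_eq[OF D(1) _ D(2)] unfolding fibre_def by blast
    show "fibre E r x \<subseteq> D"
    proof
      fix y assume y: "y \<in> fibre E r x"
      then obtain D' where D': "D' \<in> \<B>" "y \<in> D'"
        using blocks_system_cover[OF B] by (auto simp: fibre_def)
      then have "r x \<in> D'"
        using r_in[OF D'] y by (simp add: fibre_def)
      then show "y \<in> D"
        using blocks_system_disjoint[OF B D(1) D'(1)] r_in[OF D] D' by blast
    qed
  qed
  then show thesis
    using that[of r] r_in by blast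
qed

lemma (in regular_q_cycle_set) Dis_gens:
  assumes "x \<in> D" "x' \<in> D"
  shows "inv\<^bsub>BijGroup (carrier X)\<^esub> (qsigma X x) \<otimes>\<^bsub>BijGroup (carrier X)\<^esub> qsigma X x' \<in> Dis X D"
    and "inv\<^bsub>BijGroup (carrier X)\<^esub> (qdelta X x) \<otimes>\<^bsub>BijGroup (carrier X)\<^esub> qdelta X x' \<in> Dis X D"
  unfolding Dis_def Let_def using assms by (auto intro!: generate.incl)

text \<open>The \<open>Dis\<close> condition makes the partition into blocks a congruence. Its quotient is primitive
  because the fibres of the projection are the given maximal blocks.\<close>
lemma maximal_system_imp_primitive_quotient:
  fixes X :: "'a qcs"
  assumes fin: "finite_q_cycle_set X" and "indecomposable X"
    and max: "maximal_imprimitive_blocks_system (perm_group X) (carrier X) (\<lambda>g. g) \<B>"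
    and Dis: "\<And>\<Delta>. \<Delta> \<in> \<B> \<Longrightarrow> Dis X \<Delta> \<subseteq> fix_blocks (perm_group X) (\<lambda>g. g) \<B>"
  shows "\<exists>P :: 'a qcs. primitive_qcs P \<and> 1 < card (carrier P) \<and>
    card (carrier P) < card (carrier X) \<and> qcs_epi X P \<noteq> {}"
proof -
  have reg: "regular_q_cycle_set X"
    and trans: "transitive_action (perm_group X) (carrier X) (\<lambda>g. g)"
    using assms(2) by (auto simp: indecomposable_def)
  interpret X: finite_q_cycle_set X by fact
  interpret X: regular_q_cycle_set X by fact
  interpret A: transitive_action "perm_group X" "carrier X" "\<lambda>g. g" by fact
  let ?S = "BijGroup (carrier X)"
  obtain \<Delta> where \<Delta>: "\<Delta> \<in> \<B>" "maximal_block (perm_group X) (carrier X) (\<lambda>g. g) \<Delta>"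
    and B: "imprimitive_blocks_system (perm_group X) (carrier X) (\<lambda>g. g) \<B>"
    using max unfolding maximal_imprimitive_blocks_system_def by blast
  obtain r where r_in: "\<And>D. D \<in> \<B> \<Longrightarrow> r ` D \<subseteq> D"
    and fibre: "\<And>D x. D \<in> \<B> \<Longrightarrow> x \<in> D \<Longrightarrow> fibre (carrier X) r x = D"
    using A.blocks_system_representatives[OF B] by blast
  have same: "r x = r y" if "D \<in> \<B>" "x \<in> D" "y \<in> D" for D x y
    using fibre[OF that(1,3)] that(2) by (auto simp: fibre_def)
  \<comment> \<open>One argument for both operations: \<open>f\<close> stands for either of them.\<close>
  have translate: "r (f x y) = r (f x' y')"
    if f: "\<And>z. z \<in> carrier X \<Longrightarrow> (\<lambda>y \<in> carrier X. f z y) \<in> carrier (perm_group X)"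
      and gen: "\<And>D z z'. z \<in> D \<Longrightarrow> z' \<in> D \<Longrightarrow>
        inv\<^bsub>?S\<^esub> (\<lambda>y \<in> carrier X. f z y) \<otimes>\<^bsub>?S\<^esub> (\<lambda>y \<in> carrier X. f z' y) \<in> Dis X D"
      and in_X: "x \<in> carrier X" "x' \<in> carrier X" "y \<in> carrier X" "y' \<in> carrier X"
      and eq: "r x = r x'" "r y = r y'"
    for f :: "'a \<Rightarrow> 'a \<Rightarrow> 'a" and x x' y y'
  proof -
    let ?f = "\<lambda>z. \<lambda>y \<in> carrier X. f z y"
    obtain D where D: "D \<in> \<B>" "x \<in> D"
      using A.blocks_system_cover[OF B in_X(1)] by blast
    then have "x' \<in> D"
      using fibre[OF D] eq in_X by (auto simp: fibre_def)
    obtain D' where D': "D' \<in> \<B>" "y \<in> D'"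
      using A.blocks_system_cover[OF B in_X(3)] by blast
    then have "y' \<in> D'"
      using fibre[OF D'] eq in_X by (auto simp: fibre_def)
    \<comment> \<open>\<open>\<sigma>\<^bsub>x'\<^esub> = \<sigma>\<^sub>x \<circ> e\<close>, so the two products differ by moving \<open>y'\<close> inside its block.\<close>
  define e where "e = inv\<^bsub>?S\<^esub> (?f x) \<otimes>\<^bsub>?S\<^esub> ?f x'"
    have "e \<in> fix_blocks (perm_group X) (\<lambda>g. g) \<B>"
      using gen[OF D(2) \<open>x' \<in> D\<close>] Dis[OF D(1)] by (auto simp: e_def)
    then have "e ` D' = D'"
      using D'(1) by (auto simp: fix_blocks_def)
    then have "e y' \<in> D'"
      using \<open>y' \<in> D'\<close> by blast
    have Bij: "?f x \<in> Bij (carrier X)" "?f x' \<in> Bij (carrier X)"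
      using f in_X A.bij_prop0 by blast+
    then have "?f x (e y') = ?f x' y'"
      using in_X by (simp add: e_def mult_BijGroup_apply inv_in_Bij inv_BijGroup_cancel Bij_apply_in
          del: restrict_apply restrict_apply')
    then have "?f x' y' \<in> ?f x ` D'"
      using \<open>e y' \<in> D'\<close> by (metis imageI)
    moreover have "?f x y \<in> ?f x ` D'"
      using D' by blast
    ultimately have "r (?f x y) = r (?f x' y')"
      using same A.blocks_system_image[OF B f[OF in_X(1)] D'(1)] by blast
    then show ?thesis
      using in_X by simp
  qed
  have cong: "r (x \<cdot>\<^bsub>X\<^esub> y) = r (x' \<cdot>\<^bsub>X\<^esub> y') \<and> r (x \<Colon>\<^bsub>X\<^esub> y) = r (x' \<Colon>\<^bsub>X\<^esub> y')"
    if "x \<in> carrier X" "x' \<in> carrier X" "y \<in> carrier X" "y' \<in> carrier X" "r x = r x'" "r y = r y'"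
    for x x' y y'
    using translate[of "qdot X", folded qsigma_def, OF X.qsigma_in_perm_group X.Dis_gens(1) that]
      translate[of "qcolon X", folded qdelta_def, OF X.qdelta_in_perm_group X.Dis_gens(2) that]
    by simp
  define P where "P = image_qcs X r"
  have P: "r \<in> qcs_epi X P" "regular_q_cycle_set P"
    unfolding P_def
    by (rule image_qcs_epi[OF fin reg] regular_image_qcs[OF fin reg]; blast dest: cong)+
  interpret Q: factor_action "perm_group X" "carrier X" "\<lambda>g. g" "perm_group P" "carrier P" "\<lambda>g. g" r
    by (rule epi_factor_action[OF reg P(2,1)])
  have "is_block (perm_group X) (carrier X) (\<lambda>g. g) \<Delta>"
    using \<Delta>(2) by (simp add: maximal_block_def)
  then have block: "\<Delta> \<subseteq> carrier X" "\<Delta> \<noteq> carrier X" "2 \<le> card \<Delta>"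
    by (auto simp: is_block_def)
  obtain x where x: "x \<in> \<Delta>" "x \<in> carrier X"
    using block(1,3) by (cases "\<Delta> = {}") auto
  obtain y where y: "y \<in> carrier X" "y \<notin> \<Delta>"
    using block by blast
  have fin_P: "finite (carrier P)"
    using Q.surj X.finite_carrier by (metis finite_imageI)
  have "r x \<noteq> r y"
    using fibre[OF \<Delta>(1) x(1)] y by (auto simp: fibre_def)
  then have "card {r x, r y} = 2"
    by simp
  then have gt: "1 < card (carrier P)"
    using card_mono[OF fin_P, of "{r x, r y}"] Q.proj_in x y by simp
  have "\<not> inj_on r (carrier X)"
  proof
    assume inj: "inj_on r (carrier X)"
    then have "\<Delta> \<subseteq> {x}"
      using same[OF \<Delta>(1) x(1)] x block(1) by (auto dest: inj_onD)
    then show False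
      using block(3) card_mono[of "{x}" \<Delta>] by simp
  qed
  then have lt: "card (carrier P) < card (carrier X)"
    using Q.surj X.finite_carrier by (metis card_image_le eq_card_imp_inj_on le_neq_implies_less)
  have "primitive_action (perm_group P) (carrier P) (\<lambda>g. g)"
    using Q.primitive_iff_maximal_fibre[OF trans X.finite_carrier gt lt x(2)] \<Delta>(2)
      fibre[OF \<Delta>(1) x(1)] by simp
  then show ?thesis
    using P gt lt unfolding primitive_qcs_def by blast
qed

text \<open>The permutations that leave \<open>p\<close> invariant form a group, which is contained in the fixer of the
  system of fibres. So the generators of \<open>Dis\<close> are the only elements that need checking.\<close>
lemma primitive_quotient_imp_maximal_system:
  fixes X :: "'a qcs" and P :: "'b qcs"
  assumes fin: "finite_q_cycle_set X" and "indecomposable X"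
    and prim: "primitive_qcs P"
    and card: "1 < card (carrier P)" "card (carrier P) < card (carrier X)"
    and p: "p \<in> qcs_epi X P"
  shows "\<exists>\<B>. maximal_imprimitive_blocks_system (perm_group X) (carrier X) (\<lambda>g. g) \<B> \<and>
         (\<forall>\<Delta> \<in> \<B>. Dis X \<Delta> \<subseteq> fix_blocks (perm_group X) (\<lambda>g. g) \<B>)"
proof -
  have reg: "regular_q_cycle_set X"
    and trans: "transitive_action (perm_group X) (carrier X) (\<lambda>g. g)"
    using assms(2) by (auto simp: indecomposable_def)
  have reg_P: "regular_q_cycle_set P"
    and prim_P: "primitive_action (perm_group P) (carrier P) (\<lambda>g. g)"
    using prim by (auto simp: primitive_qcs_def)
  interpret X: finite_q_cycle_set X by fact
  interpret X: regular_q_cycle_set X by fact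
  interpret P: regular_q_cycle_set P by fact
  interpret Q: factor_action "perm_group X" "carrier X" "\<lambda>g. g" "perm_group P" "carrier P" "\<lambda>g. g" p
    by (rule epi_factor_action[OF reg reg_P p])
  interpret S: group "BijGroup (carrier X)"
    by (rule group_BijGroup)
  let ?S = "BijGroup (carrier X)" and ?G = "perm_group X" and ?X = "carrier X"
  obtain x where x: "x \<in> ?X"
    using X.nonempty by blast
  define \<B> where "\<B> = (\<lambda>g. g ` fibre ?X p x) ` carrier ?G"
  have max: "maximal_block ?G ?X (\<lambda>g. g) (fibre ?X p x)"
    using Q.primitive_iff_maximal_fibre[OF trans X.finite_carrier card x] prim_P by simp
  have "\<one>\<^bsub>?S\<^esub> \<in> carrier ?G"
    by (simp add: carrier_perm_group generate.one)
  moreover have "\<one>\<^bsub>?S\<^esub> ` fibre ?X p x = fibre ?X p x"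
  proof -
    have "\<one>\<^bsub>?S\<^esub> ` fibre ?X p x = (\<lambda>z. z) ` fibre ?X p x"
      by (intro image_cong) (auto simp: one_BijGroup_apply fibre_def)
    then show ?thesis by simp
  qed
  ultimately have "fibre ?X p x \<in> \<B>"
    unfolding \<B>_def by (metis imageI)
  moreover have "imprimitive_blocks_system ?G ?X (\<lambda>g. g) \<B>"
    using max unfolding imprimitive_blocks_system_def maximal_block_def \<B>_def by blast
  ultimately have "maximal_imprimitive_blocks_system ?G ?X (\<lambda>g. g) \<B>"
    using max unfolding maximal_imprimitive_blocks_system_def by blast
  moreover have fibres: "\<exists>z \<in> ?X. D = fibre ?X p z" if "D \<in> \<B>" for D
  proof -
    obtain g where "g \<in> carrier ?G" "D = g ` fibre ?X p x"
      using \<open>D \<in> \<B>\<close> by (auto simp: \<B>_def)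
    then show ?thesis
      using Q.image_fibre[of g x] Q.act_in[of g x] x by blast
  qed
  define K where "K = {g \<in> carrier ?G. \<forall>z \<in> ?X. p (g z) = p z}"
  have K_fix: "K \<subseteq> fix_blocks ?G (\<lambda>g. g) \<B>"
  proof
    fix g assume g: "g \<in> K"
    have "g ` D = D" if "D \<in> \<B>" for D
    proof -
      obtain z where "z \<in> ?X" "D = fibre ?X p z"
        using fibres \<open>D \<in> \<B>\<close> by blast
      then show ?thesis
        using g Q.image_fibre[of g z] by (simp add: K_def fibre_def)
    qed
    with g show "g \<in> fix_blocks ?G (\<lambda>g. g) \<B>"
      by (auto simp: K_def fix_blocks_def \<B>_def)
  qed
  have G_Bij: "g \<in> Bij ?X" if "g \<in> carrier ?G" for g
    using subgroup.subset[OF X.subgroup_perm_group] that by (auto simp: carrier_BijGroup)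
  have "subgroup K ?S"
  proof
    show "K \<subseteq> carrier ?S"
      using G_Bij by (auto simp: K_def carrier_BijGroup)
    show "\<one>\<^bsub>?S\<^esub> \<in> K"
      using subgroup.one_closed[OF X.subgroup_perm_group] by (simp add: K_def one_BijGroup_apply)
    show "g \<otimes>\<^bsub>?S\<^esub> h \<in> K" if "g \<in> K" "h \<in> K" for g h
      using that subgroup.m_closed[OF X.subgroup_perm_group, of g h] G_Bij
      by (auto simp: K_def mult_BijGroup_apply Bij_apply_in)
    show "inv\<^bsub>?S\<^esub> g \<in> K" if g: "g \<in> K" for g
    proof -
      have "p ((inv\<^bsub>?S\<^esub> g) z) = p z" if "z \<in> ?X" for z
      proof -
        have g_Bij: "g \<in> Bij ?X"
          using g G_Bij by (simp add: K_def)
        have "p ((inv\<^bsub>?S\<^esub> g) z) = p (g ((inv\<^bsub>?S\<^esub> g) z))"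
          using g Bij_apply_in[OF inv_in_Bij[OF g_Bij] that] by (simp add: K_def)
        then show ?thesis
          by (simp only: inv_BijGroup_cancel(2)[OF g_Bij that])
      qed
      then show ?thesis
        using g subgroup.m_inv_closed[OF X.subgroup_perm_group, of g] by (simp add: K_def)
    qed
  qed
  have quot: "inv\<^bsub>?S\<^esub> g \<otimes>\<^bsub>?S\<^esub> h \<in> K"
    if gh: "g \<in> carrier ?G" "h \<in> carrier ?G" and eq: "\<And>z. z \<in> ?X \<Longrightarrow> p (g z) = p (h z)" for g h
  proof -
    have Bij: "g \<in> Bij ?X" "h \<in> Bij ?X"
      using gh G_Bij by auto
    have "p ((inv\<^bsub>?S\<^esub> g) (h z)) = p z" if z: "z \<in> ?X" for z
    proof -
      have in_X: "(inv\<^bsub>?S\<^esub> g) (h z) \<in> ?X" "h z \<in> ?X"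
        using Bij z by (auto intro: Bij_apply_in inv_in_Bij)
      then have "p (g ((inv\<^bsub>?S\<^esub> g) (h z))) = p (g z)"
        using Bij z eq by (simp add: inv_BijGroup_cancel)
      then show ?thesis
        using Q.proj_act_eq_iff[OF gh(1)] in_X z by blast
    qed
    then show ?thesis
      using gh Bij subgroup.m_closed[OF X.subgroup_perm_group]
        subgroup.m_inv_closed[OF X.subgroup_perm_group]
      by (simp add: K_def mult_BijGroup_apply inv_in_Bij)
  qed
  have "Dis X D \<subseteq> K" if "D \<in> \<B>" for D
  proof -
    obtain z where D: "D = fibre ?X p z"
      using fibres \<open>D \<in> \<B>\<close> by blast
    have "inv\<^bsub>?S\<^esub> (qsigma X u) \<otimes>\<^bsub>?S\<^esub> qsigma X v \<in> K" "inv\<^bsub>?S\<^esub> (qdelta X u) \<otimes>\<^bsub>?S\<^esub> qdelta X v \<in> K"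
      if "u \<in> D" "v \<in> D" for u v
    proof -
      have uv: "u \<in> ?X" "v \<in> ?X" "p u = p v"
        using that by (auto simp: D fibre_def)
      show "inv\<^bsub>?S\<^esub> (qsigma X u) \<otimes>\<^bsub>?S\<^esub> qsigma X v \<in> K"
        by (rule quot) (use uv X.qsigma_in_perm_group epi_apply[OF p] in \<open>auto simp: qsigma_def\<close>)
      show "inv\<^bsub>?S\<^esub> (qdelta X u) \<otimes>\<^bsub>?S\<^esub> qdelta X v \<in> K"
        by (rule quot) (use uv X.qdelta_in_perm_group epi_apply[OF p] in \<open>auto simp: qdelta_def\<close>)
    qed
    then show ?thesis
      unfolding Dis_def Let_def by (intro S.generate_subgroup_incl \<open>subgroup K ?S\<close>) blast
  qed
  ultimately show ?thesis
    using K_fix by blast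
qed

section \<open>Chains of epimorphisms\<close>

lemma chain_card:
  assumes "primitive_chain X k Y" "i < k"
  shows "card (carrier (Y (Suc i))) + i \<le> card (carrier X)"
  using assms(2)
proof (induction i)
  case 0
  then show ?case
    using assms(1) by (simp add: primitive_chain_def)
next
  case (Suc i)
  then have "Suc i \<in> {1..k - 1}"
    by auto
  then have "card (carrier (Y (Suc (Suc i)))) < card (carrier (Y (Suc i)))"
    using assms(1) unfolding primitive_chain_def by fastforce
  with Suc show ?case
    by simp
qed

lemma chain_epi:
  assumes "primitive_chain X k Y" "i < k"
  shows "qcs_epi X (Y (Suc i)) \<noteq> {}"
  using assms(2)
proof (induction i)
  case 0
  have "(\<lambda>x. x) \<in> qcs_epi X X"
    by (auto simp: qcs_epi_def qcs_hom_def)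
  then show ?case
    using assms(1) by (auto simp: primitive_chain_def)
next
  case (Suc i)
  then have "Suc i \<in> {1..k - 1}"
    by auto
  then have "qcs_epi (Y (Suc i)) (Y (Suc (Suc i))) \<noteq> {}"
    using assms(1) unfolding primitive_chain_def by fastforce
  with Suc show ?case
    using epi_comp by (metis Suc_lessD ex_in_conv)
qed

text \<open>The last member of a chain is not empty.\<close>
lemma chain_length:
  assumes "primitive_chain X k Y" "1 \<le> k"
  shows "k \<le> card (carrier X)"
proof -
  have "k \<in> {1..k}"
    using assms(2) by simp
  then have "finite_q_cycle_set (Y k)"
    using assms(1) unfolding primitive_chain_def by blast
  then have "0 < card (carrier (Y k))"
    by (simp add: card_gt_0_iff finite_q_cycle_set.finite_carrier q_cycle_set.nonempty
        finite_q_cycle_set.axioms(1))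
  then show ?thesis
    using chain_card[OF assms(1), of "k - 1"] assms(2) by simp
qed

lemma finite_primitive_level_iff_chain:
  "finite_primitive_level X \<longleftrightarrow> (\<exists>k \<ge> 1. \<exists>Y. primitive_chain X k Y)"
proof
  assume "finite_primitive_level X"
  then show "\<exists>k \<ge> 1. \<exists>Y. primitive_chain X k Y"
    unfolding finite_primitive_level_def has_primitive_level_def by blast
next
  let ?K = "{k. 1 \<le> k \<and> (\<exists>Y. primitive_chain X k Y)}"
  assume "\<exists>k \<ge> 1. \<exists>Y. primitive_chain X k Y"
  then have "?K \<noteq> {}"
    by blast
  moreover have "?K \<subseteq> {..card (carrier X)}"
    using chain_length by auto
  then have fin: "finite ?K"
    using finite_subset by blast
  ultimately have "Max ?K \<in> ?K"
    by (intro Max_in)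
  moreover have "\<forall>l \<in> ?K. l \<le> Max ?K"
    using fin by simp
  ultimately have "has_primitive_level X (Max ?K)"
    unfolding has_primitive_level_def by blast
  then show "finite_primitive_level X"
    unfolding finite_primitive_level_def by blast
qed

theorem theorem4p2:
  fixes X :: "'a qcs"
  assumes "finite_q_cycle_set X"
    and "indecomposable X"
  shows "finite_primitive_level X \<longleftrightarrow>
    primitive_qcs X \<or>
    (\<exists>\<B>. maximal_imprimitive_blocks_system (perm_group X) (carrier X) (\<lambda>g. g) \<B> \<and>
         (\<forall>\<Delta> \<in> \<B>. Dis X \<Delta> \<subseteq> fix_blocks (perm_group X) (\<lambda>g. g) \<B>))"
    (is "_ \<longleftrightarrow> _ \<or> ?system")
proof
  assume "finite_primitive_level X"
  then obtain k Y where k: "1 \<le> k" and chain: "primitive_chain X k Y"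
    by (auto simp: finite_primitive_level_iff_chain)
  then have prim: "primitive_qcs (Y k)" and Y1: "Y 1 = X"
    by (auto simp: primitive_chain_def)
  show "primitive_qcs X \<or> ?system"
  proof (cases "k = 1")
    case True
    then show ?thesis
      using prim Y1 by simp
  next
    case False
    then have k': "k - 1 \<in> {1..k - 1}" "k - 1 + 1 = k" "Suc (k - 1) = k"
      using k by auto
    then have "1 < card (carrier (Y k))"
      using chain unfolding primitive_chain_def by metis
    moreover have "card (carrier (Y k)) < card (carrier X)"
      using chain_card[OF chain, of "k - 1"] k k' by simp
    moreover have "qcs_epi X (Y k) \<noteq> {}"
      using chain_epi[OF chain, of "k - 1"] k k' by simp
    ultimately show ?thesis
      using primitive_quotient_imp_maximal_system[OF assms prim] by blast
  qed
next
  assume "primitive_qcs X \<or> ?system"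
  then show "finite_primitive_level X"
  proof
    assume "primitive_qcs X"
    then have "primitive_chain X 1 (\<lambda>_. X)"
      using assms(1) by (simp add: primitive_chain_def)
    then show ?thesis
      using finite_primitive_level_iff_chain by blast
  next
    assume ?system
    then obtain P :: "'a qcs" where P: "primitive_qcs P" "1 < card (carrier P)"
      "card (carrier P) < card (carrier X)" "qcs_epi X P \<noteq> {}"
      using maximal_system_imp_primitive_quotient[OF assms] by blast
    have "finite_q_cycle_set P"
      using P(1,2) card_ge_0_finite[of "carrier P"]
      by (simp add: primitive_qcs_def regular_q_cycle_set_def finite_q_cycle_set_def
          finite_q_cycle_set_axioms_def)
    moreover have "{1..2::nat} = {1, 2}"
      by auto
    ultimately have "primitive_chain X 2 (\<lambda>i. if i = 1 then X else P)"
      using P assms(1) by (simp add: primitive_chain_def)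
    then show ?thesis
      using finite_primitive_level_iff_chain one_le_numeral by blast
  qed
qed

end
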